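(* The set of stationary workload vectors attainable under stable Markovian dispatch policies, $$\mathcal R_{\mathrm{st}} := \left\{(\rho_i^\eta)_{i\in\mathcal I}:\ \eta\in\mathcal H_{\mathrm{st}}\right\},$$ satisfies $$\mathcal R_{\mathrm{st}}=\left\{\rho\in[0,1)^I:\ \sum_{i\in\mathcal I}\mu_i\rho_i=\lambda,\quad \sum_{i\in S}\mu_i\rho_i\ge D(S)\ \text{ for all } S\subseteq\mathcal I\right\}.$$ Moreover, for every (possibly state-dependent) policy $\eta\in\mathcal H_{\mathrm{st}}$ there exists a stable state-independent randomized policy $\bar\eta\in\mathcal H_{\mathrm{st}}$ that has the same workload vector and the same long-run assignment rates, i.e. $\rho_i^{\bar\eta}=\rho_i^{\eta}$ for all $i\in\mathcal I$ and $x_{ei}^{\bar\eta}=x_{ei}^\eta$ for all $e\in\mathcal E$, $i\in e$.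
   Context: System. $\mathcal I=\{1,\dots,I\}$ is a finite nonempty set of servers. $\mathcal E$ is a finite set of nonempty subsets of $\mathcal I$ (hyperedges), with $e\not\subseteq e'$ for distinct $e,e'\in\mathcal E$; each $e$ represents an overlapping service region whose calls may be served by any server in $e$. Each server $i$ also has a primary region whose calls can be served only by $i$. Calls arrive by independent Poisson processes with rates $\lambda_i\ge 0$ (primary region of $i$) and $\lambda_e\ge 0$ (overlapping region $e$); $\lambda:=\sum_{i\in\mathcal I}\lambda_i+\sum_{e\in\mathcal E}\lambda_e$ is the total arrival rate. Server $i$ has exponential service times with rate $\mu_i>0$ and its own infinite-capacity queue. Dispatch policies and the Markov chain. States are vectors $B=(n_i)_{i\in\mathcal I}\in\mathbb Z_+^I$, where $n_i$ is the number of calls at server $i$ (in service plus waiting). States are enumerated as $B_u$, $u\in\mathcal U=\{0,1,2,\dots\}$, by a fixed bijection. A Markovian dispatch policy is a family $\eta=\{\eta_{e,u}: e\in\mathcal E,u\in\mathcal U\}$ where $\eta_{e,u}$ is a probability distribution on $\mathcal I$ supported on $e$; $\eta_{e,u}(i)$ is the probability that a call from region $e$ arriving in state $B_u$ is assigned to server $i$. The policy is state-independent if $\eta_{e,u}$ does not depend on $u$. Under $\eta$ the system is the continuous-time Markov chain (CTMC) on $\mathbb Z_+^I$ with transition rates (where $\mathbf e_i$ is the $i$-th unit vector): from $B_u$ to $B_u+\mathbf e_i$ at rate $\lambda_i+\sum_{e\in\mathcal E}\eta_{e,u}(i)\lambda_e$, and from $B_u$ to $B_u-\mathbf e_i$ at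 rate $\mu_i$ if $(B_u)_i>0$; no other transitions. Stability. $\mathcal H_{\mathrm{st}}$ is the set of Markovian dispatch policies under which this CTMC is positive recurrent ("stable"), in the sense that it admits a stationary probability distribution (unique, since the all-zero state is reachable from every state); it is denoted $\pi^\eta=(\pi_u^\eta)_{u\in\mathcal U}$. For $\eta\in\mathcal H_{\mathrm{st}}$, the workload of server $i$ is $\rho_i^\eta:=\sum_{u\in\mathcal U}\mathbf 1\{(B_u)_i>0\}\pi_u^\eta$, and the long-run assignment rates are $x_{ei}^\eta:=\lambda_e\sum_{u\in\mathcal U}\pi_u^\eta\,\eta_{e,u}(i)$ for $e\in\mathcal E$, $i\in e$. Trapped demand. For $S\subseteq\mathcal I$, $D(S):=\sum_{i\in S}\lambda_i+\sum_{e\in\mathcal E:\,e\subseteq S}\lambda_e$. *)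

theory Defs
  imports "HOL-Probability.Probability"
begin

text \<open>
  Servers are the elements of a finite type \<open>'i\<close>, hyperedges are sets of servers,
  and a state is a function \<open>'i \<Rightarrow> nat\<close>.  The chain lives on the indices \<open>u\<close> of an
  enumeration \<open>B\<close> of the states.  A policy is a function \<open>\<eta>\<close>; its values \<open>\<eta> e u\<close> for sets
  \<open>e\<close> that are not hyperedges are never used.
\<close>

type_synonym 'i policy = "'i set \<Rightarrow> nat \<Rightarrow> 'i pmf"

definition policies :: "'i set set \<Rightarrow> 'i policy set" where
  "policies E = {\<eta>. \<forall>e\<in>E. \<forall>u. set_pmf (\<eta> e u) \<subseteq> e}"

definition state_independent :: "'i set set \<Rightarrow> 'i policy \<Rightarrow> bool" where
  "state_independent E \<eta> \<longleftrightarrow> (\<forall>e\<in>E. \<forall>u v. \<eta> e u = \<eta> e v)"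

definition transition_rate ::
  "'i::finite set set \<Rightarrow> ('i \<Rightarrow> real) \<Rightarrow> ('i set \<Rightarrow> real) \<Rightarrow> ('i \<Rightarrow> real) \<Rightarrow> (nat \<Rightarrow> 'i \<Rightarrow> nat)
    \<Rightarrow> 'i policy \<Rightarrow> nat \<Rightarrow> nat \<Rightarrow> real" where
  "transition_rate E lamI lamE \<mu> B \<eta> u v =
     (\<Sum>i\<in>UNIV. if B v = (B u)(i := B u i + 1)
        then lamI i + (\<Sum>e\<in>E. pmf (\<eta> e u) i * lamE e) else 0)
   + (\<Sum>i\<in>UNIV. if B u i > 0 \<and> B v = (B u)(i := B u i - 1) then \<mu> i else 0)"

text \<open>The generator matrix of a family of jump rates \<open>q\<close>; the value of \<open>q u u\<close> is irrelevant.\<close>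

definition generator :: "(nat \<Rightarrow> nat \<Rightarrow> real) \<Rightarrow> nat \<Rightarrow> nat \<Rightarrow> real" where
  "generator q u v = (if u = v then - (\<Sum>w. if w = u then 0 else q u w) else q u v)"

text \<open>
  \<open>P t u\<close> is the law at time \<open>t\<close> of a continuous-time Markov chain started in \<open>u\<close> with jump
  rates \<open>q\<close>: a transition semigroup whose right derivative at time 0 is the generator.  When
  the exit rates are bounded, as for \<open>transition_rate\<close>, such a semigroup exists and is unique
  on \<open>t \<ge> 0\<close>.
\<close>

definition ctmc_semigroup :: "(nat \<Rightarrow> nat \<Rightarrow> real) \<Rightarrow> (real \<Rightarrow> nat \<Rightarrow> nat pmf) \<Rightarrow> bool" where
  "ctmc_semigroup q P \<longleftrightarrow>
     (\<forall>u. P 0 u = return_pmf u)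
   \<and> (\<forall>s\<ge>0. \<forall>t\<ge>0. \<forall>u. P (s + t) u = bind_pmf (P s u) (P t))
   \<and> (\<forall>u v. ((\<lambda>t. pmf (P t u) v) has_real_derivative generator q u v) (at 0 within {0..}))"

definition stationary :: "(nat \<Rightarrow> nat \<Rightarrow> real) \<Rightarrow> nat pmf \<Rightarrow> bool" where
  "stationary q \<pi> \<longleftrightarrow> (\<exists>P. ctmc_semigroup q P \<and> (\<forall>t\<ge>0. bind_pmf \<pi> (P t) = \<pi>))"

definition stable_policies ::
  "'i::finite set set \<Rightarrow> ('i \<Rightarrow> real) \<Rightarrow> ('i set \<Rightarrow> real) \<Rightarrow> ('i \<Rightarrow> real) \<Rightarrow> (nat \<Rightarrow> 'i \<Rightarrow> nat)
    \<Rightarrow> 'i policy set" where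
  "stable_policies E lamI lamE \<mu> B =
     {\<eta> \<in> policies E. \<exists>\<pi>. stationary (transition_rate E lamI lamE \<mu> B \<eta>) \<pi>}"

text \<open>
  The definite description is meaningful for stable policies: the stationary distribution is
  unique because the all-zero state is reachable from every state (\<open>\<mu> i > 0\<close> for all \<open>i\<close>).
\<close>

definition stationary_dist ::
  "'i::finite set set \<Rightarrow> ('i \<Rightarrow> real) \<Rightarrow> ('i set \<Rightarrow> real) \<Rightarrow> ('i \<Rightarrow> real) \<Rightarrow> (nat \<Rightarrow> 'i \<Rightarrow> nat)
    \<Rightarrow> 'i policy \<Rightarrow> nat pmf" where
  "stationary_dist E lamI lamE \<mu> B \<eta> =
     (THE \<pi>. stationary (transition_rate E lamI lamE \<mu> B \<eta>) \<pi>)"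

definition workload ::
  "'i::finite set set \<Rightarrow> ('i \<Rightarrow> real) \<Rightarrow> ('i set \<Rightarrow> real) \<Rightarrow> ('i \<Rightarrow> real) \<Rightarrow> (nat \<Rightarrow> 'i \<Rightarrow> nat)
    \<Rightarrow> 'i policy \<Rightarrow> 'i \<Rightarrow> real" where
  "workload E lamI lamE \<mu> B \<eta> i =
     (\<Sum>u. of_bool (B u i > 0) * pmf (stationary_dist E lamI lamE \<mu> B \<eta>) u)"

definition assignment_rate ::
  "'i::finite set set \<Rightarrow> ('i \<Rightarrow> real) \<Rightarrow> ('i set \<Rightarrow> real) \<Rightarrow> ('i \<Rightarrow> real) \<Rightarrow> (nat \<Rightarrow> 'i \<Rightarrow> nat)
    \<Rightarrow> 'i policy \<Rightarrow> 'i set \<Rightarrow> 'i \<Rightarrow> real" where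
  "assignment_rate E lamI lamE \<mu> B \<eta> e i =
     lamE e * (\<Sum>u. pmf (stationary_dist E lamI lamE \<mu> B \<eta>) u * pmf (\<eta> e u) i)"

definition total_rate ::
  "'i::finite set set \<Rightarrow> ('i \<Rightarrow> real) \<Rightarrow> ('i set \<Rightarrow> real) \<Rightarrow> real" where
  "total_rate E lamI lamE = (\<Sum>i\<in>UNIV. lamI i) + (\<Sum>e\<in>E. lamE e)"

definition trapped_demand ::
  "'i::finite set set \<Rightarrow> ('i \<Rightarrow> real) \<Rightarrow> ('i set \<Rightarrow> real) \<Rightarrow> 'i set \<Rightarrow> real" where
  "trapped_demand E lamI lamE S = (\<Sum>i\<in>S. lamI i) + (\<Sum>e\<in>{e\<in>E. e \<subseteq> S}. lamE e)"

end

theory Submission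
  imports Defs
begin

text \<open>
  Uniformization turns the stationary laws of the continuous-time chain into the invariant laws
  of one Markov kernel.  Rate conservation for a single queue gives
  \<open>\<mu> i * \<rho> i = lamI i + (\<Sum>e\<in>E. x e i)\<close>, so the workloads depend only on the assignment rates
  \<open>x\<close>, which form a flow from hyperedges to servers; this yields the necessary conditions.
  Conversely, splitting each region's calls independently in the proportions \<open>x e i / lamE e\<close>
  makes the servers independent M/M/1 queues with the same loads, and stability only needs
  \<open>\<rho> i < 1\<close>.  That the trapped demand inequalities suffice for a flow with prescribed loads is
  the feasibility theorem for transportation problems.
\<close>

section \<open>Expectations under discrete distributions\<close>

lemma integrable_pmf_bounded:
  fixes f :: "'a \<Rightarrow> real"
  assumes "\<And>x. \<bar>f x\<bar> \<le> C"
  shows "integrable (measure_pmf p) f"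
  by (rule measure_pmf.integrable_const_bound[where B = C]) (use assms in auto)

lemma
  fixes f :: "'a \<Rightarrow> real"
  assumes "\<And>x. \<bar>f x\<bar> \<le> C"
  shows integrable_pmf_mult_bounded: "integrable (count_space UNIV) (\<lambda>x. pmf p x * f x)"
    and integral_pmf_mult: "(\<integral>x. pmf p x * f x \<partial>count_space UNIV) = measure_pmf.expectation p f"
proof -
  have "integrable (density (count_space UNIV) (pmf p)) f"
    using integrable_pmf_bounded[OF assms, of p] by (simp add: measure_pmf_eq_density)
  then show "integrable (count_space UNIV) (\<lambda>x. pmf p x * f x)"
    by (subst (asm) integrable_density) auto
  show "(\<integral>x. pmf p x * f x \<partial>count_space UNIV) = measure_pmf.expectation p f"
    unfolding measure_pmf_eq_density by (subst integral_density) auto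
qed

lemma suminf_pmf_mult:
  fixes f :: "nat \<Rightarrow> real"
  assumes "\<And>x. \<bar>f x\<bar> \<le> C"
  shows "(\<Sum>u. pmf p u * f u) = measure_pmf.expectation p f"
  using integral_count_space_nat[OF integrable_pmf_mult_bounded[of f C p, OF assms]] integral_pmf_mult[of f C p, OF assms]
  by simp

text \<open>For nonnegative integrals the iterated formula holds for \<open>bind_pmf\<close>
  outright. The bound \<open>C\<close> keeps every integral finite, so the identity carries over to
  real expectations.\<close>

lemma expectation_bind_pmf:
  fixes f :: "'b \<Rightarrow> real"
  assumes "\<And>x. 0 \<le> f x" "\<And>x. f x \<le> C"
  shows "measure_pmf.expectation (bind_pmf p K) f
    = measure_pmf.expectation p (\<lambda>u. measure_pmf.expectation (K u) f)"
proof -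
  have C: "\<bar>f x\<bar> \<le> C" for x using assms[of x] by simp
  have E: "0 \<le> measure_pmf.expectation q f" "measure_pmf.expectation q f \<le> C" for q
  proof -
    show "0 \<le> measure_pmf.expectation q f" using assms(1) by simp
    have "measure_pmf.expectation q f \<le> measure_pmf.expectation q (\<lambda>_. C)"
      by (rule integral_mono) (use assms(2) integrable_pmf_bounded[OF C] in auto)
    then show "measure_pmf.expectation q f \<le> C" by simp
  qed
  have nn: "(\<integral>\<^sup>+x. ennreal (f x) \<partial>measure_pmf q) = ennreal (measure_pmf.expectation q f)" for q
    by (rule nn_integral_eq_integral) (use assms(1) integrable_pmf_bounded[OF C] in auto)
  have "ennreal (measure_pmf.expectation (bind_pmf p K) f)
      = (\<integral>\<^sup>+u. ennreal (measure_pmf.expectation (K u) f) \<partial>measure_pmf p)"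
    by (simp add: nn[symmetric])
  also have "\<dots> = ennreal (measure_pmf.expectation p (\<lambda>u. measure_pmf.expectation (K u) f))"
    by (rule nn_integral_eq_integral)
      (use E in \<open>auto intro!: integrable_pmf_bounded[of _ C]\<close>)
  finally show ?thesis
    using E(1) by (subst (asm) ennreal_inj) (auto intro!: integral_nonneg)
qed

section \<open>Invariant distributions of a Markov kernel\<close>

text \<open>The support of an invariant law is nonempty and closed under possible steps of
  \<open>K\<close>, so it contains every state that can be reached from all states.\<close>

lemma invariant_pmf_positive:
  assumes inv: "bind_pmf \<pi> K = \<pi>"
    and reach: "\<And>u. (u, z) \<in> {(u, v). pmf (K u) v > 0}\<^sup>*"
  shows "pmf \<pi> z > 0"
proof -
  obtain u where "u \<in> set_pmf \<pi>" using set_pmf_not_empty[of \<pi>] by blast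
  have "z \<in> set_pmf \<pi>"
    using reach[of u] \<open>u \<in> set_pmf \<pi>\<close>
  proof (induction rule: rtrancl_induct)
    case (step v w)
    then have "w \<in> set_pmf (bind_pmf \<pi> K)"
      by (auto simp: pmf_positive_iff intro!: bexI[of _ v])
    then show ?case by (simp add: inv)
  qed
  then show ?thesis by (simp add: pmf_positive)
qed

text \<open>Let \<open>A\<close> be the set where \<open>\<pi>'\<close> exceeds
  \<open>\<pi>\<close>. Under an invariant law the one-step change \<open>g\<close> of the mass in
  \<open>A\<close> has mean zero, so the difference of the two laws times \<open>g\<close>
  integrates to zero. This product is nonnegative on \<open>A\<close> and off \<open>A\<close>,
  hence vanishes everywhere. Thus \<open>A\<close> cannot be left, and if nonempty it would contain
  \<open>z\<close>, against the assumption at \<open>z\<close>.\<close>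

lemma invariant_pmf_le:
  assumes inv: "bind_pmf \<pi> K = \<pi>" "bind_pmf \<pi>' K = \<pi>'"
    and reach: "\<And>u. (u, z) \<in> {(u, v). pmf (K u) v > 0}\<^sup>*"
    and le: "pmf \<pi>' z \<le> pmf \<pi> z"
  shows "pmf \<pi>' u \<le> pmf \<pi> u"
proof -
  define A where "A = {u. pmf \<pi>' u > pmf \<pi> u}"
  define g :: "_ \<Rightarrow> real" where "g u = indicator A u - measure (K u) A" for u
  have g1: "\<bar>g u\<bar> \<le> 1" for u
    using measure_pmf.prob_le_1[of "K u" A] measure_nonneg[of "K u" A]
    unfolding g_def indicator_def by (simp split: if_splits)
  have zero: "measure_pmf.expectation p g = 0" if "bind_pmf p K = p" for p
  proof -
    have "measure_pmf.expectation p g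
        = measure_pmf.expectation p (indicator A) - measure_pmf.expectation p (\<lambda>u. measure (K u) A)"
      unfolding g_def
      by (rule Bochner_Integration.integral_diff) (auto intro!: integrable_pmf_bounded[of _ 1])
    also have "measure_pmf.expectation p (\<lambda>u. measure (K u) A) = measure p A"
      using expectation_bind_pmf[of "indicator A" 1 p K] that by simp
    finally show ?thesis by simp
  qed
  define h where "h u = pmf \<pi>' u * g u - pmf \<pi> u * g u" for u
  have h0: "h u \<ge> 0" for u
  proof (cases "u \<in> A")
    case True
    then show ?thesis
      using measure_pmf.prob_le_1[of "K u" A]
      by (auto simp: h_def g_def A_def simp flip: left_diff_distrib)
  next
    case False
    then have "(pmf \<pi>' u - pmf \<pi> u) * (- measure (K u) A) \<ge> 0"
      by (intro mult_nonpos_nonpos) (auto simp: A_def)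
    then show ?thesis using False by (simp add: h_def g_def algebra_simps)
  qed
  have int: "integrable (count_space UNIV) h"
    unfolding h_def by (intro Bochner_Integration.integrable_diff integrable_pmf_mult_bounded[OF g1])
  have "integral\<^sup>L (count_space UNIV) h = 0"
    unfolding h_def
    by (subst Bochner_Integration.integral_diff)
      (auto intro!: integrable_pmf_mult_bounded[OF g1] simp: integral_pmf_mult[OF g1] zero inv)
  then have h: "h u = 0" for u
    using integral_nonneg_eq_0_iff_AE[OF int] h0 by (simp add: AE_count_space)
  \<comment> \<open>On \<open>A\<close> the difference of the two laws is strictly positive, so
    \<open>h u = 0\<close> forces \<open>g u = 0\<close>.\<close>
  have closed: "v \<in> A" if "u \<in> A" "pmf (K u) v > 0" for u v
  proof -
    have "measure (K u) A = 1"
      using h[of u] that(1) by (auto simp: h_def g_def A_def simp flip: left_diff_distrib)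
    then have "set_pmf (K u) \<subseteq> A"
      by (simp add: measure_pmf.prob_eq_1 AE_measure_pmf_iff subset_eq)
    then show ?thesis using that(2) by (auto simp: set_pmf_iff)
  qed
  have "u \<notin> A"
  proof
    assume "u \<in> A"
    have "z \<in> A" using reach[of u] \<open>u \<in> A\<close>
      by (induction rule: rtrancl_induct) (auto intro: closed)
    then show False using le by (simp add: A_def)
  qed
  then show ?thesis by (simp add: A_def not_less)
qed

text \<open>Both laws have total mass one, so the nonnegative difference integrates to zero.\<close>

lemma pmf_le_imp_eq:
  assumes "\<And>u. pmf p u \<le> pmf q u"
  shows "p = q"
proof (rule pmf_eqI)
  fix u
  have "integrable (count_space UNIV) (\<lambda>x. pmf q x - pmf p x)"
    by (intro Bochner_Integration.integrable_diff integrable_pmf)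
  moreover have "(\<integral>x. pmf q x - pmf p x \<partial>count_space UNIV) = 0"
    by (subst Bochner_Integration.integral_diff) (auto simp: integrable_pmf integral_pmf)
  ultimately show "pmf p u = pmf q u"
    using integral_nonneg_eq_0_iff_AE[of "count_space UNIV" "\<lambda>x. pmf q x - pmf p x"] assms
    by (auto simp: AE_count_space)
qed

text \<open>Values at \<open>z\<close> are linearly ordered; the law that is smaller there is
  smaller everywhere, hence equal to the other.\<close>

lemma invariant_pmf_unique:
  assumes "bind_pmf \<pi> K = \<pi>" "bind_pmf \<pi>' K = \<pi>'"
    and "\<And>u. (u, z) \<in> {(u, v). pmf (K u) v > 0}\<^sup>*"
  shows "\<pi> = \<pi>'"
proof (cases "pmf \<pi>' z \<le> pmf \<pi> z")
  case True
  show ?thesis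
    using pmf_le_imp_eq[of \<pi>' \<pi>] invariant_pmf_le[OF assms True] by simp
next
  case False
  then have "pmf \<pi> z \<le> pmf \<pi>' z" by simp
  from pmf_le_imp_eq[of \<pi> \<pi>'] invariant_pmf_le[OF assms(2,1,3) this] show ?thesis by simp
qed

text \<open>Detailed balance summed over \<open>u\<close>; the row \<open>K v\<close> has mass
  one.\<close>

lemma reversible_imp_invariant:
  assumes "\<And>u v. pmf \<pi> u * pmf (K u) v = pmf \<pi> v * pmf (K v) u"
  shows "bind_pmf \<pi> K = \<pi>"
proof (rule pmf_eqI)
  fix v
  have "pmf (bind_pmf \<pi> K) v = (\<integral>u. pmf \<pi> u * pmf (K u) v \<partial>count_space UNIV)"
    by (subst integral_pmf_mult[of _ 1]) (auto simp: pmf_bind pmf_le_1)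
  also have "\<dots> = pmf \<pi> v * (\<integral>u. pmf (K v) u \<partial>count_space UNIV)"
    by (subst assms) simp
  finally show "pmf (bind_pmf \<pi> K) v = pmf \<pi> v" by (simp add: integral_pmf)
qed

section \<open>Uniformization\<close>

text \<open>The derivative is read off along \<open>t / Suc n\<close>: for subadditivity this cuts
  \<open>[0, t]\<close> into equal pieces, and for dominated convergence it supplies a sequence
  (with \<open>t = 1\<close>).\<close>

lemma tendsto_along_within_0:
  fixes f :: "real \<Rightarrow> real"
  assumes f: "(f has_real_derivative D) (at 0 within {0..})" and t: "t > 0"
  shows "(\<lambda>n. (f (t / real (Suc n)) - f 0) / (t / real (Suc n))) \<longlonglongrightarrow> D"
proof -
  have lim: "((\<lambda>y. (f y - f 0) / y) \<longlongrightarrow> D) (at 0 within {0..})"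
    using f by (simp add: has_field_derivative_iff)
  have "(\<lambda>n. t * inverse (real (Suc n))) \<longlonglongrightarrow> t * 0"
    by (intro tendsto_intros LIMSEQ_inverse_real_of_nat)
  then have "filterlim (\<lambda>n. t / real (Suc n)) (at 0 within {0..}) sequentially"
    using t by (auto simp: filterlim_at divide_inverse intro!: always_eventually simp del: of_nat_Suc)
  from filterlim_compose[OF lim this] show ?thesis by simp
qed

text \<open>The Markov property makes the escape probability subadditive in time, so that its
  derivative at 0 bounds it globally.\<close>

lemma ctmc_escape_le:
  assumes P: "ctmc_semigroup q P" and t: "t \<ge> 0"
  shows "1 - pmf (P t u) u \<le> - generator q u u * t"
proof -
  define h where "h t = 1 - pmf (P t u) u" for t
  have h0: "h 0 = 0" using P by (simp add: ctmc_semigroup_def h_def)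
  \<comment> \<open>Being at \<open>u\<close> at time \<open>s\<close> and again \<open>r\<close>
    later is one way of being at \<open>u\<close> at time \<open>s + r\<close>. With p and p' the
    return probabilities at \<open>s\<close> and \<open>r\<close>, this and (1 - p)(1 - p') >= 0
    give subadditivity.\<close>
  have add: "h (s + r) \<le> h s + h r" if "s \<ge> 0" "r \<ge> 0" for s r
  proof -
    have "pmf (P s u) u * pmf (P r u) u
        = measure_pmf.expectation (P s u) (\<lambda>w. indicator {u} w * pmf (P r u) u)"
      by (simp add: measure_pmf_single)
    also have "\<dots> \<le> measure_pmf.expectation (P s u) (\<lambda>w. pmf (P r w) u)"
      by (intro integral_mono integrable_pmf_bounded[of _ 1])
        (auto simp: indicator_def pmf_le_1)
    also have "\<dots> = pmf (P (s + r) u) u"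
      using P that by (simp add: ctmc_semigroup_def pmf_bind)
    finally have "pmf (P s u) u * pmf (P r u) u \<le> pmf (P (s + r) u) u" .
    moreover have "(1 - pmf (P s u) u) * (1 - pmf (P r u) u) \<ge> 0"
      by (simp add: pmf_le_1)
    ultimately show ?thesis by (simp add: h_def algebra_simps)
  qed
  have mult: "h (real n * s) \<le> real n * h s" if "s \<ge> 0" for n s
  proof (induction n)
    case (Suc n)
    have "h (real n * s + s) \<le> h (real n * s) + h s" by (rule add) (use that in auto)
    then show ?case using Suc by (simp add: algebra_simps)
  qed (simp add: h0)
  have d: "(h has_real_derivative - generator q u u) (at 0 within {0..})"
    using P unfolding ctmc_semigroup_def h_def by (auto intro!: derivative_eq_intros)
  show ?thesis
  proof (cases "t = 0")
    case False
    then have "t > 0" using t by simp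
    have "h t / t \<le> - generator q u u"
    proof (rule tendsto_lowerbound[OF tendsto_along_within_0[OF d \<open>t > 0\<close>]])
      \<comment> \<open>Subadditivity over \<open>Suc n\<close> equal pieces bounds
        \<open>h t\<close> by \<open>Suc n\<close> times \<open>h (t / Suc n)\<close>.\<close>
      show "\<forall>\<^sub>F n in sequentially. h t / t \<le> (h (t / real (Suc n)) - h 0) / (t / real (Suc n))"
        using mult[of "t / real (Suc n)" "Suc n" for n] \<open>t > 0\<close> h0
        by (intro always_eventually allI) (simp add: field_simps del: of_nat_Suc)
    qed simp
    then show ?thesis using \<open>t > 0\<close> by (simp add: h_def field_simps)
  qed (use h0 in \<open>simp add: h_def\<close>)
qed

text \<open>Differentiating the invariance under \<open>P t\<close> at time 0 gives that
  \<open>\<pi>\<close> annihilates the generator, which is L(K - I). Limit and sum over states may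
  be exchanged because the escape bound dominates all difference quotients by the constant
  \<open>L\<close>.\<close>

lemma invariant_of_stationary:
  assumes st: "stationary q \<pi>" and L: "L > 0"
    and gen: "\<And>u v. generator q u v = L * (pmf (K u) v - of_bool (u = v))"
  shows "bind_pmf \<pi> K = \<pi>"
proof (rule pmf_eqI)
  fix v
  obtain P where P: "ctmc_semigroup q P" and inv: "\<And>t. t \<ge> 0 \<Longrightarrow> bind_pmf \<pi> (P t) = \<pi>"
    using st by (auto simp: stationary_def)
  have P0: "P 0 u = return_pmf u" for u using P by (simp add: ctmc_semigroup_def)
  have delta: "measure_pmf.expectation \<pi> (\<lambda>u. of_bool (u = v)) = pmf \<pi> v"
    by (subst integral_measure_pmf_real[of "{v}"]) auto
  define s where "s n u = (pmf (P (1 / real (Suc n)) u) v - of_bool (u = v)) * real (Suc n)" for n u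
  have "(\<lambda>n. measure_pmf.expectation \<pi> (s n)) \<longlonglongrightarrow> measure_pmf.expectation \<pi> (\<lambda>u. generator q u v)"
  proof (rule integral_dominated_convergence)
    show "AE u in \<pi>. (\<lambda>n. s n u) \<longlonglongrightarrow> generator q u v"
    proof (rule AE_I2)
      fix u
      have "((\<lambda>t. pmf (P t u) v) has_real_derivative generator q u v) (at 0 within {0..})"
        using P by (simp add: ctmc_semigroup_def)
      from tendsto_along_within_0[OF this, of 1]
      show "(\<lambda>n. s n u) \<longlonglongrightarrow> generator q u v"
        by (simp add: s_def P0 indicator_def of_bool_def eq_commute del: of_nat_Suc)
    qed
    show "AE u in \<pi>. norm (s n u) \<le> L" for n
    proof (rule AE_I2)
      fix u
      define t where "t = 1 / real (Suc n)"
      have t: "t > 0" by (simp add: t_def)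
      have esc: "1 - pmf (P t u) u \<le> L * t"
      proof -
        have "1 - pmf (P t u) u \<le> - generator q u u * t"
          using ctmc_escape_le[OF P, of t u] t by simp
        also have "\<dots> \<le> L * t"
          using L t by (intro mult_right_mono) (auto simp: gen algebra_simps)
        finally show ?thesis .
      qed
      \<comment> \<open>For distinct states the mass at \<open>v\<close> is part of the mass that
        has left \<open>u\<close>; for equal states both sides coincide.\<close>
      have "\<bar>pmf (P t u) v - of_bool (u = v)\<bar> \<le> 1 - pmf (P t u) u"
      proof (cases "u = v")
        case False
        have "pmf (P t u) v + pmf (P t u) u = measure (P t u) {v, u}"
          using False by (simp add: measure_measure_pmf_finite)
        also have "\<dots> \<le> 1" by simp
        finally show ?thesis using False by simp
      qed (simp add: pmf_le_1)
      then have "\<bar>pmf (P t u) v - of_bool (u = v)\<bar> * real (Suc n) \<le> L * t * real (Suc n)"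
        using esc by (intro mult_right_mono) auto
      then show "norm (s n u) \<le> L"
        by (simp add: s_def t_def abs_mult del: of_nat_Suc)
    qed
  qed auto
  moreover have "measure_pmf.expectation \<pi> (s n) = 0" for n
  proof -
    have "measure_pmf.expectation \<pi> (\<lambda>u. pmf (P (1 / real (Suc n)) u) v) = pmf \<pi> v"
      using inv[of "1 / real (Suc n)"] by (simp add: pmf_bind[symmetric])
    then show ?thesis
      unfolding s_def using delta
      by (simp add: Bochner_Integration.integral_diff integrable_pmf_bounded[of _ 1] pmf_le_1)
  qed
  ultimately have "measure_pmf.expectation \<pi> (\<lambda>u. generator q u v) = 0"
    by (simp add: LIMSEQ_const_iff)
  then show "pmf (bind_pmf \<pi> K) v = pmf \<pi> v"
    using L delta
    by (simp add: gen pmf_bind Bochner_Integration.integral_diff integrable_pmf_bounded[of _ 1] pmf_le_1)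
qed

section \<open>Construction of a semigroup from a Poisson clock\<close>

lemma poisson_pmf_add:
  assumes "a > 0" "b > 0"
  shows "bind_pmf (poisson_pmf a) (\<lambda>m. map_pmf ((+) m) (poisson_pmf b)) = poisson_pmf (a + b)"
proof (rule pmf_eqI)
  fix k
  have shift: "pmf (map_pmf ((+) m) (poisson_pmf b)) k
      = (if m \<le> k then pmf (poisson_pmf b) (k - m) else 0)" for m
  proof (cases "m \<le> k")
    case True
    then show ?thesis
      using pmf_map_inj'[of "(+) m" "poisson_pmf b" "k - m"] by simp
  next
    case False
    then show ?thesis by (auto simp: pmf_eq_0_set_pmf)
  qed
  have "pmf (bind_pmf (poisson_pmf a) (\<lambda>m. map_pmf ((+) m) (poisson_pmf b))) k
      = (\<Sum>m\<le>k. pmf (poisson_pmf b) (k - m) * pmf (poisson_pmf a) m)"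
    unfolding pmf_bind shift
    by (subst integral_measure_pmf_real[of "{..k}"]) (auto split: if_splits)
  \<comment> \<open>The convolution sum is arranged as a term of the product of two exponential
    series; the binomial theorem then collapses it.\<close>
  also have "\<dots> = exp (- (a + b)) * (\<Sum>m\<le>k. (a ^ m /\<^sub>R fact m) * (b ^ (k - m) /\<^sub>R fact (k - m)))"
    using assms by (simp add: sum_distrib_left exp_add[symmetric] mult_ac divide_inverse)
      (simp add: exp_add mult_ac exp_diff exp_minus divide_inverse)
  also have "\<dots> = pmf (poisson_pmf (a + b)) k"
    using assms exp_series_add_commuting[of a b k] by (simp add: divide_inverse mult_ac)
  finally show "pmf (bind_pmf (poisson_pmf a) (\<lambda>m. map_pmf ((+) m) (poisson_pmf b))) k
      = pmf (poisson_pmf (a + b)) k" .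
qed

text \<open>The n-step transition kernel, written as an iterate of the map on laws so that the
  Chapman-Kolmogorov equation becomes additivity of \<open>funpow\<close>.\<close>

definition kernel_power :: "('a \<Rightarrow> 'a pmf) \<Rightarrow> nat \<Rightarrow> 'a \<Rightarrow> 'a pmf" where
  "kernel_power K n u = ((\<lambda>p. bind_pmf p K) ^^ n) (return_pmf u)"

lemma bind_kernel_power: "bind_pmf p (kernel_power K n) = ((\<lambda>p. bind_pmf p K) ^^ n) p"
proof (induction n)
  case 0
  have "kernel_power K 0 = return_pmf" by (rule ext) (simp add: kernel_power_def)
  then show ?case by (simp add: bind_return_pmf')
next
  case (Suc n)
  have "kernel_power K (Suc n) = (\<lambda>u. bind_pmf (kernel_power K n u) K)"
    by (rule ext) (simp add: kernel_power_def)
  then show ?case using Suc by (simp flip: bind_assoc_pmf)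
qed

lemma kernel_power_add:
  "bind_pmf (kernel_power K m u) (kernel_power K n) = kernel_power K (m + n) u"
  unfolding bind_kernel_power by (subst add.commute) (simp add: kernel_power_def funpow_add)

text \<open>The case distinction is needed because \<^term>\<open>poisson_pmf 0\<close> is unspecified.\<close>

definition uniformized :: "real \<Rightarrow> ('a \<Rightarrow> 'a pmf) \<Rightarrow> real \<Rightarrow> 'a \<Rightarrow> 'a pmf" where
  "uniformized L K t u =
     (if t = 0 then return_pmf u else bind_pmf (poisson_pmf (L * t)) (\<lambda>n. kernel_power K n u))"

lemma uniformized_zero: "uniformized L K 0 = return_pmf"
  by (rule ext) (simp add: uniformized_def)

text \<open>The event counts of two consecutive time intervals are independent Poisson variables,
  and their sum drives the chain over the union.\<close>

lemma uniformized_add: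
  assumes "L > 0" "s \<ge> 0" "t \<ge> 0"
  shows "uniformized L K (s + t) u = bind_pmf (uniformized L K s u) (uniformized L K t)"
proof (cases "s = 0 \<or> t = 0")
  case True
  then show ?thesis by (auto simp: uniformized_zero bind_return_pmf bind_return_pmf')
next
  case False
  then have pos: "L * s > 0" "L * t > 0" "s + t \<noteq> 0" using assms by auto
  have "uniformized L K (s + t) u
      = bind_pmf (bind_pmf (poisson_pmf (L * s)) (\<lambda>m. map_pmf ((+) m) (poisson_pmf (L * t))))
          (\<lambda>n. kernel_power K n u)"
    using pos by (simp add: uniformized_def poisson_pmf_add distrib_left)
  also have "\<dots> = bind_pmf (poisson_pmf (L * s)) (\<lambda>m. bind_pmf (poisson_pmf (L * t))
      (\<lambda>n. bind_pmf (kernel_power K m u) (kernel_power K n)))"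
    by (simp add: bind_assoc_pmf bind_map_pmf kernel_power_add)
  \<comment> \<open>The second event count is drawn independently of the position after the first
    \<open>m\<close> steps, so the two draws can be exchanged.\<close>
  also have "\<dots> = bind_pmf (poisson_pmf (L * s)) (\<lambda>m. bind_pmf (kernel_power K m u)
      (\<lambda>w. bind_pmf (poisson_pmf (L * t)) (\<lambda>n. kernel_power K n w)))"
    by (subst bind_commute_pmf) simp
  also have "\<dots> = bind_pmf (uniformized L K s u) (uniformized L K t)"
    using False by (simp add: uniformized_def[abs_def] bind_assoc_pmf)
  finally show ?thesis .
qed

text \<open>The transition probability is \<open>exp (- L * t)\<close> times the power series
  \<open>f\<close> at \<open>L * t\<close>, whose coefficients are n-step probabilities over
  factorials. The series converges everywhere by comparison with the exponential, and the derivative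
  at 0 involves only \<open>c 0\<close> and \<open>c 1\<close>.\<close>

lemma uniformized_has_derivative:
  assumes L: "L > 0"
  shows "((\<lambda>t. pmf (uniformized L K t u) v) has_real_derivative
    L * (pmf (K u) v - of_bool (u = v))) (at 0 within {0..})"
proof -
  define c where "c n = pmf (kernel_power K n u) v / fact n" for n
  have c0: "c 0 = of_bool (u = v)" by (simp add: c_def kernel_power_def indicator_def)
  have c1: "c 1 = pmf (K u) v" by (simp add: c_def kernel_power_def bind_return_pmf)
  have summ: "summable (\<lambda>n. c n * y ^ n)" for y :: real
  proof (rule summable_comparison_test')
    show "summable (\<lambda>n. \<bar>y\<bar> ^ n /\<^sub>R fact n)" by (rule summable_exp_generic)
    show "norm (c n * y ^ n) \<le> \<bar>y\<bar> ^ n /\<^sub>R fact n" for n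
      using mult_right_mono[of "pmf (kernel_power K n u) v" 1 "\<bar>y\<bar> ^ n / fact n"]
      by (simp add: c_def abs_mult power_abs divide_inverse mult_ac pmf_le_1)
  qed
  define f where "f y = (\<Sum>n. c n * y ^ n)" for y :: real
  have "(f has_real_derivative (\<Sum>n. diffs c n * 0 ^ n)) (at 0)"
    unfolding f_def[abs_def] using termdiffs_strong_converges_everywhere[of c 0] summ by blast
  then have f': "(f has_real_derivative c 1) (at (L * 0))"
    by (simp add: diffs_def)
  have "((\<lambda>t. f (L * t)) has_real_derivative c 1 * L) (at 0)"
    by (rule DERIV_chain2[where g = "\<lambda>t. L * t", OF f']) (auto intro!: derivative_eq_intros)
  moreover have "((\<lambda>t. exp (- L * t)) has_real_derivative - L) (at 0)"
    by (auto intro!: derivative_eq_intros)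
  ultimately have "((\<lambda>t. exp (- L * t) * f (L * t)) has_real_derivative
      - L * f (L * 0) + c 1 * L * exp (- L * 0)) (at 0)"
    by (intro DERIV_mult)
  moreover have "- L * f (L * 0) + c 1 * L * exp (- L * 0) = L * (pmf (K u) v - of_bool (u = v))"
    by (simp add: f_def c0 c1[simplified] algebra_simps)
  ultimately have "((\<lambda>t. exp (- L * t) * f (L * t)) has_real_derivative
      L * (pmf (K u) v - of_bool (u = v))) (at 0 within {0..})"
    by (simp only: has_field_derivative_at_within)
  \<comment> \<open>The analytic formula is differentiable from both sides; it is matched with
    \<open>uniformized\<close> for nonnegative times only.\<close>
  then show ?thesis
  proof (rule has_field_derivative_transform_within[of _ _ _ _ 1])
    fix t :: real
    assume "t \<in> {0..}"
    show "exp (- L * t) * f (L * t) = pmf (uniformized L K t u) v"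
    proof (cases "t = 0")
      case True
      then show ?thesis by (simp add: uniformized_def f_def c0 indicator_def)
    next
      case False
      then have Lt: "L * t > 0" using L \<open>t \<in> {0..}\<close> by simp
      have "pmf (uniformized L K t u) v
          = (\<Sum>n. pmf (poisson_pmf (L * t)) n * pmf (kernel_power K n u) v)"
        using False by (subst suminf_pmf_mult[of _ 1]) (auto simp: uniformized_def pmf_bind pmf_le_1)
      also have "\<dots> = (\<Sum>n. exp (- L * t) * (c n * (L * t) ^ n))"
        using Lt by (simp add: c_def mult_ac)
      also have "\<dots> = exp (- L * t) * f (L * t)"
        unfolding f_def by (rule suminf_mult[OF summ])
      finally show ?thesis by simp
    qed
  qed auto
qed

text \<open>The uniformized semigroup is the witness. Invariance under one step passes to all powers
  of \<open>K\<close> and then to their Poisson mixtures.\<close>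

lemma stationary_of_invariant:
  assumes inv: "bind_pmf \<pi> K = \<pi>" and L: "L > 0"
    and gen: "\<And>u v. generator q u v = L * (pmf (K u) v - of_bool (u = v))"
  shows "stationary q \<pi>"
proof -
  have "ctmc_semigroup q (uniformized L K)"
    unfolding ctmc_semigroup_def gen
    using uniformized_add[OF L] uniformized_has_derivative[OF L]
    by (auto simp only: uniformized_zero)
  moreover have "bind_pmf \<pi> (uniformized L K t) = \<pi>" if "t \<ge> 0" for t
  proof (cases "t = 0")
    case True
    then show ?thesis by (simp add: uniformized_zero bind_return_pmf')
  next
    case False
    have "((\<lambda>p. bind_pmf p K) ^^ n) \<pi> = \<pi>" for n by (induction n) (simp_all add: inv)
    then have "bind_pmf (poisson_pmf (L * t)) (\<lambda>n. bind_pmf \<pi> (kernel_power K n)) = \<pi>"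
      by (simp add: bind_kernel_power)
    then show ?thesis
      using False by (subst (asm) bind_commute_pmf) (simp add: uniformized_def[abs_def])
  qed
  ultimately show ?thesis by (auto simp: stationary_def)
qed

lemma stationary_iff_invariant:
  assumes "L > 0" "\<And>u v. generator q u v = L * (pmf (K u) v - of_bool (u = v))"
  shows "stationary q \<pi> \<longleftrightarrow> bind_pmf \<pi> K = \<pi>"
  using invariant_of_stationary[OF _ assms] stationary_of_invariant[OF _ assms] by blast

section \<open>The transportation problem\<close>

text \<open>Greedy algorithm on a polymatroid: each coordinate is raised until it meets a tight set,
  and tight sets are closed under union by submodularity.\<close>

lemma polymatroid_greedy:
  fixes f :: "'i::finite set \<Rightarrow> real"
  assumes nonneg: "\<And>S. f S \<ge> 0" and empty: "f {} = 0"
    and submod: "\<And>S T. f (S \<union> T) + f (S \<inter> T) \<le> f S + f T"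
  shows "\<exists>y. (\<forall>i. 0 \<le> y i) \<and> (\<forall>i. i \<notin> A \<longrightarrow> y i = 0)
      \<and> (\<forall>S. sum y S \<le> f S) \<and> (\<exists>T. A \<subseteq> T \<and> sum y T = f T)"
proof (induction A rule: finite_induct[OF finite])
  case 1
  then show ?case using nonneg empty by (intro exI[of _ "\<lambda>_. 0"]) auto
next
  case (2 a A)
  then obtain y T where y: "\<And>i. 0 \<le> y i" "\<And>i. i \<notin> A \<Longrightarrow> y i = 0" "\<And>S. sum y S \<le> f S"
    and T: "A \<subseteq> T" "sum y T = f T" by auto
  \<comment> \<open>The largest increase of coordinate \<open>a\<close> that respects all
    constraints; a minimizing set \<open>S0\<close> becomes tight.\<close>
  define \<delta> where "\<delta> = Min ((\<lambda>S. f S - sum y S) ` {S. a \<in> S})"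
  have fin: "finite ((\<lambda>S. f S - sum y S) ` {S. a \<in> S})" by simp
  have ne: "(\<lambda>S. f S - sum y S) ` {S. a \<in> S} \<noteq> {}" by auto
  obtain S0 where S0: "a \<in> S0" "\<delta> = f S0 - sum y S0"
    using Min_in[OF fin ne] unfolding \<delta>_def by auto
  have \<delta>_le: "\<delta> \<le> f S - sum y S" if "a \<in> S" for S
    unfolding \<delta>_def by (rule Min_le[OF fin]) (use that in auto)
  have \<delta>_nonneg: "\<delta> \<ge> 0" using S0 y(3) by simp
  define z where "z i = y i + (if i = a then \<delta> else 0)" for i
  have sum_z: "sum z S = sum y S + (if a \<in> S then \<delta> else 0)" for S
    by (simp add: z_def sum.distrib)
  have z_le: "sum z S \<le> f S" for S
    using \<delta>_le[of S] y(3)[of S] unfolding sum_z by (cases "a \<in> S") simp_all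
  have "sum z S0 = f S0" using S0 by (simp add: sum_z)
  \<comment> \<open>The old tight set survives: if it contains \<open>a\<close>, its zero slack
    forces \<open>\<delta> = 0\<close>.\<close>
  have "sum z T = f T"
    using T(2) \<delta>_le[of T] \<delta>_nonneg by (auto simp: sum_z)
  have "sum z (T \<union> S0) = f (T \<union> S0)"
  proof (rule antisym[OF z_le])
    have "f (T \<union> S0) + f (T \<inter> S0) \<le> sum z T + sum z S0"
      using submod[of T S0] \<open>sum z S0 = f S0\<close> \<open>sum z T = f T\<close> by simp
    also have "\<dots> = sum z (T \<union> S0) + sum z (T \<inter> S0)"
      by (simp add: sum.union_inter)
    finally show "f (T \<union> S0) \<le> sum z (T \<union> S0)"
      using z_le[of "T \<inter> S0"] by simp
  qed
  moreover have "0 \<le> z i" "i \<notin> insert a A \<Longrightarrow> z i = 0" for i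
    using y(1,2) \<delta>_nonneg by (auto simp: z_def)
  moreover have "insert a A \<subseteq> T \<union> S0" using T(1) S0(1) by auto
  ultimately show ?case using z_le by blast
qed

text \<open>An edge lies in both sets iff it lies in their intersection; the inequality drops the
  edges that fit only into the union.\<close>

lemma trapped_weight_supermodular:
  fixes w :: "'i set \<Rightarrow> real"
  assumes "finite E" "\<And>e. e \<in> E \<Longrightarrow> w e \<ge> 0"
  shows "sum w {e\<in>E. e \<subseteq> S} + sum w {e\<in>E. e \<subseteq> T}
    \<le> sum w {e\<in>E. e \<subseteq> S \<union> T} + sum w {e\<in>E. e \<subseteq> S \<inter> T}"
proof -
  let ?D = "\<lambda>S. {e\<in>E. e \<subseteq> S}"
  have "sum w (?D S) + sum w (?D T) = sum w (?D S \<union> ?D T) + sum w (?D S \<inter> ?D T)"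
    using assms(1) by (simp add: sum.union_inter)
  also have "?D S \<inter> ?D T = ?D (S \<inter> T)" by auto
  also have "sum w (?D S \<union> ?D T) \<le> sum w (?D (S \<union> T))"
    using assms by (intro sum_mono2) auto
  finally show ?thesis by simp
qed

text \<open>Induction on the edges. The edge \<open>e0\<close> is shipped first, by a vector
  \<open>z\<close> chosen so that the remaining capacities \<open>c - z\<close> satisfy the
  hypothesis for the other edges. The slack \<open>f\<close> left by those edges is submodular, so
  the greedy vector \<open>y\<close> supported on \<open>e0\<close> respects it and is tight on a
  set containing \<open>e0\<close>; such a vector is large enough to carry
  \<open>w e0\<close>.\<close>

lemma transport_feasible:
  fixes w :: "'i::finite set \<Rightarrow> real" and c :: "'i \<Rightarrow> real"
  assumes "finite E" "{} \<notin> E" "\<And>e. e \<in> E \<Longrightarrow> w e \<ge> 0"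
    and "\<And>S. sum w {e\<in>E. e \<subseteq> S} \<le> sum c S"
  shows "\<exists>x. (\<forall>e\<in>E. (\<forall>i. 0 \<le> x e i) \<and> (\<forall>i. i \<notin> e \<longrightarrow> x e i = 0) \<and> (\<Sum>i\<in>UNIV. x e i) = w e)
    \<and> (\<forall>i. (\<Sum>e\<in>E. x e i) \<le> c i)"
  using assms
proof (induction E arbitrary: c rule: finite_induct)
  case empty
  have "0 \<le> c i" for i using empty(3)[of "{i}"] by simp
  then show ?case by simp
next
  case (insert e0 E)
  define D where "D S = sum w {e\<in>E. e \<subseteq> S}" for S
  define f where "f S = sum c S - D S" for S
  have D_insert: "sum w {e\<in>insert e0 E. e \<subseteq> S} = D S + (if e0 \<subseteq> S then w e0 else 0)" for S
  proof -
    have "{e\<in>insert e0 E. e \<subseteq> S} = (if e0 \<subseteq> S then insert e0 {e\<in>E. e \<subseteq> S} else {e\<in>E. e \<subseteq> S})"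
      by auto
    then show ?thesis using insert(1,2) by (simp add: D_def)
  qed
  have f_ge: "(if e0 \<subseteq> S then w e0 else 0) \<le> f S" for S
    using insert.prems(3)[of S] unfolding D_insert f_def by linarith
  have w0: "w e0 \<ge> 0" using insert.prems(2) by simp
  have f_nonneg: "f S \<ge> 0" for S using f_ge[of S] w0 by (cases "e0 \<subseteq> S") simp_all
  have f_empty: "f {} = 0"
  proof -
    have "{e\<in>E. e \<subseteq> {}} = {}" using insert.prems(1) by auto
    then have "D {} = 0" by (simp only: D_def sum.empty)
    then show ?thesis by (simp add: f_def)
  qed
  have submod: "f (S \<union> T) + f (S \<inter> T) \<le> f S + f T" for S T
  proof -
    have "D S + D T \<le> D (S \<union> T) + D (S \<inter> T)"
      unfolding D_def using insert.hyps(1) insert.prems(2) by (intro trapped_weight_supermodular) simp_all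
    moreover have "sum c (S \<union> T) + sum c (S \<inter> T) = sum c S + sum c T"
      by (simp add: sum.union_inter)
    ultimately show ?thesis by (simp add: f_def)
  qed
  obtain y T where y: "\<And>i. 0 \<le> y i" "\<And>i. i \<notin> e0 \<Longrightarrow> y i = 0" "\<And>S. sum y S \<le> f S"
    and T: "e0 \<subseteq> T" "sum y T = f T"
    using polymatroid_greedy[of f e0, OF f_nonneg f_empty submod] by blast
  \<comment> \<open>The total of \<open>y\<close> is at least \<open>f T\<close>, and
    \<open>f T\<close> is at least \<open>w e0\<close> because \<open>T\<close> contains
    \<open>e0\<close>.\<close>
  have "sum y T \<le> sum y UNIV" by (rule sum_mono2) (use y in auto)
  then have ge: "w e0 \<le> sum y UNIV" using f_ge[of T] T by simp
  \<comment> \<open>Scaling down brings the total to exactly \<open>w e0\<close> and keeps the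
    vector below the slack.\<close>
  define r where "r = (if w e0 = 0 then 0 else w e0 / sum y UNIV)"
  have r: "0 \<le> r" "r \<le> 1" "r * sum y UNIV = w e0"
    using ge w0 by (auto simp: r_def)
  define z where "z i = r * y i" for i
  have z: "0 \<le> z i" "i \<notin> e0 \<Longrightarrow> z i = 0" "z i \<le> y i" for i
    using r y mult_right_mono[of r 1 "y i"] by (auto simp: z_def)
  have z_sum: "(\<Sum>i\<in>UNIV. z i) = w e0" using r by (simp add: z_def sum_distrib_left)
  have "\<exists>x. (\<forall>e\<in>E. (\<forall>i. 0 \<le> x e i) \<and> (\<forall>i. i \<notin> e \<longrightarrow> x e i = 0) \<and> (\<Sum>i\<in>UNIV. x e i) = w e)
      \<and> (\<forall>i. (\<Sum>e\<in>E. x e i) \<le> c i - z i)"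
  proof (rule insert.IH[of "\<lambda>i. c i - z i"])
    show "sum w {e\<in>E. e \<subseteq> S} \<le> (\<Sum>i\<in>S. c i - z i)" for S
    proof -
      have "sum z S \<le> sum y S" by (rule sum_mono) (use z in auto)
      then show ?thesis using y(3)[of S] by (simp add: f_def D_def sum_subtractf)
    qed
  qed (use insert.prems(1,2) in simp_all)
  then obtain x where x: "\<forall>e\<in>E. (\<forall>i. 0 \<le> x e i) \<and> (\<forall>i. i \<notin> e \<longrightarrow> x e i = 0) \<and> (\<Sum>i\<in>UNIV. x e i) = w e"
    and x_le: "\<forall>i. (\<Sum>e\<in>E. x e i) \<le> c i - z i"
    by (elim exE conjE)
  have sum_eq: "(\<Sum>e\<in>E. (x(e0 := z)) e i) = (\<Sum>e\<in>E. x e i)" for i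
    using insert(2) by (intro sum.cong) auto
  have "(\<Sum>e\<in>insert e0 E. (x(e0 := z)) e i) \<le> c i" for i
    using x_le[rule_format, of i] insert(1,2) sum_eq[of i] by (simp add: algebra_simps)
  moreover have "(\<forall>i. 0 \<le> (x(e0 := z)) e i) \<and> (\<forall>i. i \<notin> e \<longrightarrow> (x(e0 := z)) e i = 0)
      \<and> (\<Sum>i\<in>UNIV. (x(e0 := z)) e i) = w e" if "e \<in> insert e0 E" for e
    using x z z_sum that by (cases "e = e0") simp_all
  ultimately show ?case by (intro exI[of _ "x(e0 := z)"]) simp
qed

section \<open>Dispatch systems\<close>

locale dispatch_system =
  fixes E :: "'i::finite set set"
    and lamI :: "'i \<Rightarrow> real"
    and lamE :: "'i set \<Rightarrow> real"
    and \<mu> :: "'i \<Rightarrow> real"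
    and B :: "nat \<Rightarrow> 'i \<Rightarrow> nat"
  assumes nonempty: "{} \<notin> E"
    and lamI_nonneg: "\<And>i. lamI i \<ge> 0"
    and lamE_nonneg: "\<And>e. e \<in> E \<Longrightarrow> lamE e \<ge> 0"
    and mu_pos: "\<And>i. \<mu> i > 0"
    and bij: "bij B"
begin

section \<open>The event-driven kernel of the dispatch chain\<close>

definition arrival :: "'i policy \<Rightarrow> nat \<Rightarrow> 'i \<Rightarrow> real" where
  "arrival \<eta> u i = lamI i + (\<Sum>e\<in>E. pmf (\<eta> e u) i * lamE e)"

definition L :: real where
  "L = total_rate E lamI lamE + sum \<mu> UNIV"

definition up :: "nat \<Rightarrow> 'i \<Rightarrow> nat" where
  "up u i = inv B ((B u)(i := B u i + 1))"

text \<open>A service completion at an empty queue leaves the state unchanged, since \<open>0 - 1 = 0\<close>;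
  hence the total event rate \<open>L\<close> is the same in all states.\<close>

definition down :: "nat \<Rightarrow> 'i \<Rightarrow> nat" where
  "down u i = inv B ((B u)(i := B u i - 1))"

text \<open>An event (\<open>Inl\<close> an arrival, \<open>Inr\<close> a service completion) is
  drawn with probability proportional to its rate and then applied. Mapping from events to states
  merges those with the same target, such as services at several empty queues.\<close>

definition kernel :: "'i policy \<Rightarrow> nat \<Rightarrow> nat pmf" where
  "kernel \<eta> u = map_pmf (case_sum (up u) (down u))
     (embed_pmf (\<lambda>x. case_sum (arrival \<eta> u) \<mu> x / L))"

lemma B_inv [simp]: "B (inv B s) = s"
  by (rule surj_f_inv_f[OF bij_is_surj[OF bij]])

lemma inv_B [simp]: "inv B (B u) = u"
  by (rule inv_f_f[OF bij_is_inj[OF bij]])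

lemma B_up [simp]: "B (up u i) = (B u)(i := B u i + 1)"
  and B_down [simp]: "B (down u i) = (B u)(i := B u i - 1)"
  by (simp_all add: up_def down_def)

lemma up_eq_iff: "up u i = v \<longleftrightarrow> B v = (B u)(i := B u i + 1)"
  and down_eq_iff: "down u i = v \<longleftrightarrow> B v = (B u)(i := B u i - 1)"
  by (metis B_up inv_B, metis B_down inv_B)

lemma up_neq [simp]: "up u i \<noteq> u"
  by (auto simp: up_eq_iff fun_eq_iff)

lemma down_eq_self_iff: "down u i = u \<longleftrightarrow> B u i = 0"
proof -
  have "down u i = u \<longleftrightarrow> B u i = B u i - 1"
    by (auto simp: down_eq_iff fun_eq_iff)
  then show ?thesis by auto
qed

lemma down_up [simp]: "down (up u i) i = u"
  by (simp add: down_eq_iff)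

lemma up_down: "B u i > 0 \<Longrightarrow> up (down u i) i = u"
  by (simp add: up_eq_iff)

lemma arrival_nonneg: "arrival \<eta> u i \<ge> 0"
  unfolding arrival_def
  by (intro add_nonneg_nonneg sum_nonneg mult_nonneg_nonneg lamI_nonneg lamE_nonneg pmf_nonneg)

text \<open>A policy only redistributes calls, so the total is the same in all states; this permits
  a single uniformization constant.\<close>

lemma arrival_sum: "(\<Sum>i\<in>UNIV. arrival \<eta> u i) = total_rate E lamI lamE"
proof -
  have "(\<Sum>i\<in>UNIV. \<Sum>e\<in>E. pmf (\<eta> e u) i * lamE e) = (\<Sum>e\<in>E. (\<Sum>i\<in>UNIV. pmf (\<eta> e u) i) * lamE e)"
    by (subst sum.swap) (simp add: sum_distrib_right)
  also have "\<dots> = (\<Sum>e\<in>E. lamE e)"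
    by (simp add: sum_pmf_eq_1)
  finally show ?thesis by (simp add: arrival_def sum.distrib total_rate_def)
qed

lemma total_rate_nonneg: "total_rate E lamI lamE \<ge> 0"
  unfolding total_rate_def by (intro add_nonneg_nonneg sum_nonneg lamI_nonneg lamE_nonneg)

lemma L_pos: "L > 0"
  unfolding L_def using total_rate_nonneg
  by (intro add_nonneg_pos sum_pos) (auto simp: mu_pos)

lemma arrival_le: "arrival \<eta> u i \<le> L"
proof -
  have "arrival \<eta> u i \<le> total_rate E lamI lamE"
    using member_le_sum[of i UNIV "arrival \<eta> u"] arrival_nonneg by (simp add: arrival_sum)
  moreover have "sum \<mu> UNIV \<ge> 0" by (intro sum_nonneg) (simp add: mu_pos less_imp_le)
  ultimately show ?thesis by (simp add: L_def)
qed

lemma mu_le: "\<mu> i \<le> L"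
  using member_le_sum[of i UNIV \<mu>] total_rate_nonneg mu_pos
  by (simp add: L_def less_imp_le add_increasing)

lemma sum_sum_type:
  fixes f :: "'i + 'i \<Rightarrow> real"
  shows "sum f UNIV = (\<Sum>i\<in>UNIV. f (Inl i)) + (\<Sum>i\<in>UNIV. f (Inr i))"
  by (subst UNIV_Plus_UNIV[symmetric], subst sum.Plus) simp_all

lemma pmf_event:
  "pmf (embed_pmf (\<lambda>x. case_sum (arrival \<eta> u) \<mu> x / L)) y = case_sum (arrival \<eta> u) \<mu> y / L"
proof (rule pmf_embed_pmf)
  show nonneg: "0 \<le> case_sum (arrival \<eta> u) \<mu> x / L" for x
    using L_pos arrival_nonneg mu_pos
    by (intro divide_nonneg_pos) (auto split: sum.split simp: less_imp_le)
  have "(\<integral>\<^sup>+x. ennreal (case_sum (arrival \<eta> u) \<mu> x / L) \<partial>count_space UNIV)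
      = ennreal (\<Sum>x\<in>UNIV. case_sum (arrival \<eta> u) \<mu> x / L)"
    by (subst nn_integral_count_space_finite) (auto simp: sum_ennreal nonneg)
  also have "(\<Sum>x\<in>UNIV. case_sum (arrival \<eta> u) \<mu> x / L) = 1"
    using L_pos by (simp add: sum_sum_type arrival_sum L_def flip: sum_divide_distrib add_divide_distrib)
  finally show "(\<integral>\<^sup>+x. ennreal (case_sum (arrival \<eta> u) \<mu> x / L) \<partial>count_space UNIV) = 1" by simp
qed

lemma expectation_kernel:
  fixes f :: "nat \<Rightarrow> real"
  shows "measure_pmf.expectation (kernel \<eta> u) f
    = ((\<Sum>i\<in>UNIV. f (up u i) * arrival \<eta> u i) + (\<Sum>i\<in>UNIV. f (down u i) * \<mu> i)) / L"
  unfolding kernel_def integral_map_pmf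
  by (subst integral_measure_pmf_real[of UNIV])
    (auto simp: pmf_event sum_sum_type add_divide_distrib sum_divide_distrib)

lemma pmf_kernel:
  "pmf (kernel \<eta> u) v = ((\<Sum>i\<in>UNIV. of_bool (up u i = v) * arrival \<eta> u i)
    + (\<Sum>i\<in>UNIV. of_bool (down u i = v) * \<mu> i)) / L"
proof -
  have "pmf (kernel \<eta> u) v = measure_pmf.expectation (kernel \<eta> u) (\<lambda>w. of_bool (w = v))"
    by (subst integral_measure_pmf_real[of "{v}"]) auto
  then show ?thesis by (simp only: expectation_kernel)
qed

lemma transition_rate_eq:
  "transition_rate E lamI lamE \<mu> B \<eta> u v = (if u = v then 0 else L * pmf (kernel \<eta> u) v)"
proof -
  have "transition_rate E lamI lamE \<mu> B \<eta> u v = (\<Sum>i\<in>UNIV. of_bool (up u i = v) * arrival \<eta> u i)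
      + (\<Sum>i\<in>UNIV. of_bool (B u i > 0 \<and> down u i = v) * \<mu> i)"
    unfolding transition_rate_def up_eq_iff down_eq_iff arrival_def
    by (intro arg_cong2[of _ _ _ _ "(+)"] sum.cong) auto
  \<comment> \<open>A service event fixes the state exactly when the queue is empty, so off the
    diagonal the guard \<open>B u i > 0\<close> is automatic.\<close>
  moreover have "B u i > 0 \<and> down u i = v \<longleftrightarrow> u \<noteq> v \<and> down u i = v" for i
    using down_eq_self_iff[of u i] by auto
  ultimately show ?thesis
    using L_pos by (auto simp: pmf_kernel)
qed

lemma generator_eq:
  "generator (transition_rate E lamI lamE \<mu> B \<eta>) u v = L * (pmf (kernel \<eta> u) v - of_bool (u = v))"
proof (cases "u = v")
  case True
  let ?p = "kernel \<eta> u"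
  \<comment> \<open>The exit rate is the mean under \<open>kernel\<close> of a function that equals
    \<open>L\<close> off \<open>u\<close> and vanishes at \<open>u\<close>.\<close>
  have "(\<Sum>w. if w = u then 0 else transition_rate E lamI lamE \<mu> B \<eta> u w)
      = (\<Sum>w. pmf ?p w * (L - L * indicator {u} w))"
    by (rule suminf_cong) (auto simp: transition_rate_eq)
  also have "\<dots> = measure_pmf.expectation ?p (\<lambda>w. L - L * indicator {u} w)"
    by (rule suminf_pmf_mult[of _ L]) (use L_pos in \<open>auto simp: indicator_def\<close>)
  also have "\<dots> = L - L * pmf ?p u"
    by (subst Bochner_Integration.integral_diff)
      (auto simp: measure_pmf_single intro!: integrable_pmf_bounded[of _ 1])
  finally show ?thesis by (simp add: generator_def right_diff_distrib flip: True)
qed (simp add: generator_def transition_rate_eq)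

lemma stationary_iff:
  "stationary (transition_rate E lamI lamE \<mu> B \<eta>) \<pi> \<longleftrightarrow> bind_pmf \<pi> (kernel \<eta>) = \<pi>"
  by (rule stationary_iff_invariant[OF L_pos generator_eq])

section \<open>Uniqueness of the stationary law and its functionals\<close>

abbreviation origin :: nat where
  "origin \<equiv> inv B (\<lambda>_. 0)"

text \<open>Serving any nonempty queue has positive probability and lowers the total number of
  calls.\<close>

lemma origin_reachable: "(u, origin) \<in> {(u, v). pmf (kernel \<eta> u) v > 0}\<^sup>*"
proof (induction "sum (B u) UNIV" arbitrary: u rule: less_induct)
  case less
  show ?case
  proof (cases "\<forall>i. B u i = 0")
    case True
    then have "B u = (\<lambda>_. 0)" by auto
    then have "u = origin" by (metis inv_B)
    then show ?thesis by simp
  next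
    case False
    then obtain i where i: "B u i > 0" by auto
    have "0 < \<mu> i / L" using mu_pos L_pos by simp
    also have "\<mu> i / L \<le> pmf (kernel \<eta> u) (down u i)"
    proof -
      have "\<mu> i \<le> (\<Sum>j\<in>UNIV. of_bool (down u j = down u i) * \<mu> j)"
        using member_le_sum[of i UNIV "\<lambda>j. of_bool (down u j = down u i) * \<mu> j"] mu_pos
        by (simp add: less_imp_le)
      moreover have "0 \<le> (\<Sum>j\<in>UNIV. of_bool (up u j = down u i) * arrival \<eta> u j)"
        by (intro sum_nonneg) (simp add: arrival_nonneg)
      ultimately show ?thesis
        unfolding pmf_kernel using L_pos by (intro divide_right_mono) auto
    qed
    finally have step: "(u, down u i) \<in> {(u, v). pmf (kernel \<eta> u) v > 0}" by simp
    have "sum (B (down u i)) UNIV < sum (B u) UNIV"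
      by (rule sum_strict_mono_ex1) (use i in auto)
    from less[OF this] step show ?thesis by (rule converse_rtrancl_into_rtrancl[rotated])
  qed
qed

lemma stationary_dist_eq:
  assumes "bind_pmf \<pi> (kernel \<eta>) = \<pi>"
  shows "stationary_dist E lamI lamE \<mu> B \<eta> = \<pi>"
  unfolding stationary_dist_def stationary_iff
  using assms invariant_pmf_unique[OF _ _ origin_reachable] by (intro the_equality) blast+

lemma stable_iff:
  "\<eta> \<in> stable_policies E lamI lamE \<mu> B \<longleftrightarrow> \<eta> \<in> policies E \<and> (\<exists>\<pi>. bind_pmf \<pi> (kernel \<eta>) = \<pi>)"
  by (simp add: stable_policies_def stationary_iff)

lemma workload_eq:
  assumes "bind_pmf \<pi> (kernel \<eta>) = \<pi>"
  shows "workload E lamI lamE \<mu> B \<eta> i = measure_pmf.expectation \<pi> (\<lambda>u. of_bool (B u i > 0))"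
  unfolding workload_def stationary_dist_eq[OF assms]
  by (subst suminf_pmf_mult[of _ 1, symmetric]) (auto simp: mult.commute)

lemma assignment_rate_eq:
  assumes "bind_pmf \<pi> (kernel \<eta>) = \<pi>"
  shows "assignment_rate E lamI lamE \<mu> B \<eta> e i
    = lamE e * measure_pmf.expectation \<pi> (\<lambda>u. pmf (\<eta> e u) i)"
  unfolding assignment_rate_def stationary_dist_eq[OF assms]
  by (subst suminf_pmf_mult[of _ 1]) (auto simp: pmf_le_1)

text \<open>Stationarity is applied to the truncated queue lengths \<open>min (B u i) N\<close>, because the queue
  length itself need not be integrable.\<close>

lemma rate_conservation:
  assumes inv: "bind_pmf \<pi> (kernel \<eta>) = \<pi>"
  shows "measure_pmf.expectation \<pi> (\<lambda>u. arrival \<eta> u i)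
    = \<mu> i * measure_pmf.expectation \<pi> (\<lambda>u. of_bool (B u i > 0))"
proof -
  \<comment> \<open>\<open>d N u / L\<close> is the mean one-step change of the truncated queue
    length.\<close>
  define d where "d N u = arrival \<eta> u i * of_bool (B u i < N)
    - \<mu> i * of_bool (0 < B u i \<and> B u i \<le> N)" for N u
  have d_le: "\<bar>d N u\<bar> \<le> L" for N u
    using arrival_nonneg[of \<eta> u i] arrival_le[of \<eta> u i] mu_le[of i] mu_pos[of i] L_pos
    by (auto simp: d_def of_bool_def)
  have zero: "measure_pmf.expectation \<pi> (d N) = 0" for N
  proof -
    define f where "f u = real (min (B u i) N)" for u
    have f_le: "0 \<le> f u" "f u \<le> real N" for u by (auto simp: f_def)
    \<comment> \<open>Truncation at \<open>N\<close> hides an arrival at level \<open>N\<close> or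
      above, but a departure only above level \<open>N\<close>; hence the strict bound here and the
      weak one in \<open>f_down\<close>.\<close>
    have f_up: "f (up u j) = f u + of_bool (j = i) * of_bool (B u i < N)" for u j
      by (auto simp: f_def min_def)
    have f_down: "f (down u j) = f u - of_bool (j = i) * of_bool (0 < B u i \<and> B u i \<le> N)" for u j
      by (auto simp: f_def min_def of_nat_diff)
    have "measure_pmf.expectation (kernel \<eta> u) f = f u + d N u / L" for u
    proof -
      have "(\<Sum>j\<in>UNIV. f (up u j) * arrival \<eta> u j)
          = f u * total_rate E lamI lamE + of_bool (B u i < N) * arrival \<eta> u i"
        by (simp add: f_up distrib_right sum.distrib mult.assoc arrival_sum flip: sum_distrib_left)
      moreover have "(\<Sum>j\<in>UNIV. f (down u j) * \<mu> j)
          = f u * sum \<mu> UNIV - of_bool (0 < B u i \<and> B u i \<le> N) * \<mu> i"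
        by (simp add: f_down left_diff_distrib sum_subtractf mult.assoc flip: sum_distrib_left)
      ultimately have "measure_pmf.expectation (kernel \<eta> u) f = (f u * L + d N u) / L"
        unfolding expectation_kernel by (simp add: L_def d_def algebra_simps)
      then show ?thesis using L_pos by (simp add: add_divide_distrib)
    qed
    then have "measure_pmf.expectation \<pi> f = measure_pmf.expectation \<pi> (\<lambda>u. f u + d N u / L)"
      using expectation_bind_pmf[of f "real N" \<pi> "kernel \<eta>", OF f_le] inv by simp
    also have "\<dots> = measure_pmf.expectation \<pi> f + measure_pmf.expectation \<pi> (d N) / L"
      using f_le d_le
      by (subst Bochner_Integration.integral_add)
        (auto intro!: integrable_pmf_bounded[of f "real N"] integrable_pmf_bounded[of "d N" L])
    finally show ?thesis using L_pos by simp
  qed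
  have "(\<lambda>N. measure_pmf.expectation \<pi> (d N))
      \<longlonglongrightarrow> measure_pmf.expectation \<pi> (\<lambda>u. arrival \<eta> u i - \<mu> i * of_bool (B u i > 0))"
  proof (rule integral_dominated_convergence[where w = "\<lambda>_. L"])
    \<comment> \<open>For a fixed state, both truncation indicators are settled once
      \<open>N\<close> exceeds the queue length.\<close>
    have "eventually (\<lambda>N. d N u = arrival \<eta> u i - \<mu> i * of_bool (B u i > 0)) sequentially" for u
      using eventually_gt_at_top[of "B u i"] by eventually_elim (simp add: d_def)
    then show "AE u in \<pi>. (\<lambda>N. d N u) \<longlonglongrightarrow> arrival \<eta> u i - \<mu> i * of_bool (B u i > 0)"
      by (intro AE_I2 tendsto_eventually)
  qed (use d_le in auto)
  then have "measure_pmf.expectation \<pi> (\<lambda>u. arrival \<eta> u i - \<mu> i * of_bool (B u i > 0)) = 0"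
    by (simp add: zero LIMSEQ_const_iff)
  moreover have "measure_pmf.expectation \<pi> (\<lambda>u. arrival \<eta> u i - \<mu> i * of_bool (B u i > 0))
      = measure_pmf.expectation \<pi> (\<lambda>u. arrival \<eta> u i)
        - \<mu> i * measure_pmf.expectation \<pi> (\<lambda>u. of_bool (B u i > 0))"
    using integrable_pmf_bounded[of "\<lambda>u. arrival \<eta> u i" L] arrival_nonneg arrival_le
    by (subst Bochner_Integration.integral_diff) (auto intro!: integrable_pmf_bounded[of _ 1])
  ultimately show ?thesis by simp
qed

section \<open>Flow balance and the necessary conditions\<close>

lemma mu_workload:
  assumes "\<eta> \<in> stable_policies E lamI lamE \<mu> B"
  shows "\<mu> i * workload E lamI lamE \<mu> B \<eta> i
    = lamI i + (\<Sum>e\<in>E. assignment_rate E lamI lamE \<mu> B \<eta> e i)"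
proof -
  obtain \<pi> where inv: "bind_pmf \<pi> (kernel \<eta>) = \<pi>" using assms by (auto simp: stable_iff)
  have int: "integrable \<pi> (\<lambda>u. pmf (\<eta> e u) i)" for e
    by (rule integrable_pmf_bounded[of _ 1]) (simp add: pmf_le_1)
  have "\<mu> i * workload E lamI lamE \<mu> B \<eta> i = measure_pmf.expectation \<pi> (\<lambda>u. arrival \<eta> u i)"
    by (simp add: workload_eq[OF inv] rate_conservation[OF inv])
  also have "\<dots> = lamI i + (\<Sum>e\<in>E. measure_pmf.expectation \<pi> (\<lambda>u. pmf (\<eta> e u) i * lamE e))"
    unfolding arrival_def using int
    by (subst Bochner_Integration.integral_add) (auto simp: Bochner_Integration.integral_sum)
  finally show ?thesis by (simp add: assignment_rate_eq[OF inv] mult.commute)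
qed

text \<open>Being a probability distribution supported on \<open>e\<close> is expressed by linear
  constraints, which survive averaging over the stationary law.\<close>

lemma assignment_rate_flow:
  assumes "\<eta> \<in> stable_policies E lamI lamE \<mu> B" and e: "e \<in> E"
  shows "assignment_rate E lamI lamE \<mu> B \<eta> e i \<ge> 0"
    and "i \<notin> e \<Longrightarrow> assignment_rate E lamI lamE \<mu> B \<eta> e i = 0"
    and "(\<Sum>i\<in>UNIV. assignment_rate E lamI lamE \<mu> B \<eta> e i) = lamE e"
proof -
  obtain \<pi> where inv: "bind_pmf \<pi> (kernel \<eta>) = \<pi>" and \<eta>: "\<eta> \<in> policies E"
    using assms by (auto simp: stable_iff)
  have int: "integrable \<pi> (\<lambda>u. pmf (\<eta> e u) i)" for i
    by (rule integrable_pmf_bounded[of _ 1]) (simp add: pmf_le_1)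
  show "assignment_rate E lamI lamE \<mu> B \<eta> e i \<ge> 0"
    by (simp add: assignment_rate_eq[OF inv] lamE_nonneg[OF e])
  show "assignment_rate E lamI lamE \<mu> B \<eta> e i = 0" if "i \<notin> e"
  proof -
    have "pmf (\<eta> e u) i = 0" for u
      using \<eta> e that by (auto simp: policies_def pmf_eq_0_set_pmf)
    then show ?thesis by (simp add: assignment_rate_eq[OF inv])
  qed
  have "(\<Sum>i\<in>UNIV. assignment_rate E lamI lamE \<mu> B \<eta> e i)
      = lamE e * measure_pmf.expectation \<pi> (\<lambda>u. \<Sum>i\<in>UNIV. pmf (\<eta> e u) i)"
    using int by (simp add: assignment_rate_eq[OF inv] Bochner_Integration.integral_sum sum_distrib_left)
  then show "(\<Sum>i\<in>UNIV. assignment_rate E lamI lamE \<mu> B \<eta> e i) = lamE e"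
    by (simp add: sum_pmf_eq_1)
qed

text \<open>Strictness comes from the positive stationary mass of \<open>origin\<close>, where
  server \<open>i\<close> is idle.\<close>

lemma workload_bounds:
  assumes "\<eta> \<in> stable_policies E lamI lamE \<mu> B"
  shows "0 \<le> workload E lamI lamE \<mu> B \<eta> i" "workload E lamI lamE \<mu> B \<eta> i < 1"
proof -
  obtain \<pi> where inv: "bind_pmf \<pi> (kernel \<eta>) = \<pi>" using assms by (auto simp: stable_iff)
  have int: "integrable \<pi> (\<lambda>u. of_bool (B u i > 0) :: real)"
    by (rule integrable_pmf_bounded[of _ 1]) simp
  show "0 \<le> workload E lamI lamE \<mu> B \<eta> i"
    by (simp add: workload_eq[OF inv])
  have "workload E lamI lamE \<mu> B \<eta> i + pmf \<pi> origin
      = measure_pmf.expectation \<pi> (\<lambda>u. of_bool (B u i > 0) + indicator {origin} u)"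
    using int by (subst Bochner_Integration.integral_add)
      (auto simp: workload_eq[OF inv] measure_pmf_single intro!: integrable_pmf_bounded[of _ 1])
  also have "\<dots> \<le> measure_pmf.expectation \<pi> (\<lambda>u. 1)"
    by (intro integral_mono integrable_pmf_bounded[of _ 2]) (auto simp: indicator_def)
  finally show "workload E lamI lamE \<mu> B \<eta> i < 1"
    using invariant_pmf_positive[OF inv origin_reachable] by simp
qed

text \<open>Edges inside \<open>S\<close> send all their flow to servers in \<open>S\<close>; all
  other edges contribute a nonnegative amount there.\<close>

lemma trapped_demand_le_workload:
  assumes "\<eta> \<in> stable_policies E lamI lamE \<mu> B"
  shows "trapped_demand E lamI lamE S \<le> (\<Sum>i\<in>S. \<mu> i * workload E lamI lamE \<mu> B \<eta> i)"
proof -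
  let ?x = "assignment_rate E lamI lamE \<mu> B \<eta>"
  note flow = assignment_rate_flow[OF assms]
  have "(\<Sum>e\<in>{e\<in>E. e \<subseteq> S}. lamE e) \<le> (\<Sum>e\<in>{e\<in>E. e \<subseteq> S}. \<Sum>i\<in>S. ?x e i)"
  proof (rule sum_mono)
    fix e assume e: "e \<in> {e\<in>E. e \<subseteq> S}"
    then have "lamE e = (\<Sum>i\<in>UNIV. ?x e i)" using flow(3) by simp
    also have "\<dots> = (\<Sum>i\<in>S. ?x e i)"
      using e flow(2) by (intro sum.mono_neutral_right) auto
    finally show "lamE e \<le> (\<Sum>i\<in>S. ?x e i)" by simp
  qed
  also have "\<dots> \<le> (\<Sum>e\<in>E. \<Sum>i\<in>S. ?x e i)"
    using flow(1) by (intro sum_mono2 sum_nonneg) auto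
  also have "\<dots> = (\<Sum>i\<in>S. \<Sum>e\<in>E. ?x e i)" by (rule sum.swap)
  finally show ?thesis
    by (simp add: trapped_demand_def mu_workload[OF assms] sum.distrib)
qed

lemma total_rate_eq_workload:
  assumes "\<eta> \<in> stable_policies E lamI lamE \<mu> B"
  shows "(\<Sum>i\<in>UNIV. \<mu> i * workload E lamI lamE \<mu> B \<eta> i) = total_rate E lamI lamE"
proof -
  have "(\<Sum>i\<in>UNIV. \<Sum>e\<in>E. assignment_rate E lamI lamE \<mu> B \<eta> e i) = (\<Sum>e\<in>E. lamE e)"
    by (subst sum.swap) (simp add: assignment_rate_flow(3)[OF assms])
  then show ?thesis by (simp add: mu_workload[OF assms] sum.distrib total_rate_def)
qed

text \<open>Under constant arrival rates the queues are independent M/M/1 queues, and the product of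
  their geometric stationary laws is reversible.\<close>

lemma product_geometric_invariant:
  assumes arr: "\<And>u i. arrival \<eta> u i = \<mu> i * r i"
    and r: "\<And>i. 0 \<le> r i" "\<And>i. r i < 1"
  shows "\<exists>\<pi>. bind_pmf \<pi> (kernel \<eta>) = \<pi>"
proof -
  \<comment> \<open>A geometric law with success probability \<open>1 - r i\<close> has weights
    \<open>r i ^ k * (1 - r i)\<close>, the M/M/1 queue length law at load
    \<open>r i\<close>.\<close>
  define \<pi> where "\<pi> = map_pmf (inv B) (Pi_pmf UNIV 0 (\<lambda>i. geometric_pmf (1 - r i)))"
  have pmf_\<pi>: "pmf \<pi> u = (\<Prod>i\<in>UNIV. r i ^ B u i * (1 - r i))" for u
  proof -
    have "pmf \<pi> (inv B (B u)) = pmf (Pi_pmf UNIV 0 (\<lambda>i. geometric_pmf (1 - r i))) (B u)"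
      unfolding \<pi>_def by (rule pmf_map_inj') (rule bij_is_inj[OF bij_imp_bij_inv[OF bij]])
    also have "\<dots> = (\<Prod>i\<in>UNIV. r i ^ B u i * (1 - r i))"
      using r by (subst pmf_Pi') (auto simp: pmf_geometric less_imp_le)
    finally show ?thesis by simp
  qed
  have \<pi>_up: "pmf \<pi> (up u i) = r i * pmf \<pi> u" for u i
    unfolding pmf_\<pi> by (subst (1 2) prod.remove[of _ i]) auto
  \<comment> \<open>Detailed balance for a single server. Distinctness of \<open>u\<close> and
    \<open>v\<close> excludes services at an empty queue, the only case in which \<open>up\<close>
    does not undo \<open>down\<close>.\<close>
  have up_term: "of_bool (up u i = v) * arrival \<eta> u i * pmf \<pi> u
      = of_bool (down v i = u) * \<mu> i * pmf \<pi> v" if "u \<noteq> v" for u v i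
  proof (cases "up u i = v")
    case True
    then show ?thesis using down_up[of u i] by (auto simp: \<pi>_up arr)
  next
    case False
    have "down v i \<noteq> u"
    proof
      assume "down v i = u"
      then have "B v i > 0" using that down_eq_self_iff[of v i] by auto
      then show False using False up_down[of v i] \<open>down v i = u\<close> by simp
    qed
    then show ?thesis using False by simp
  qed
  have "pmf \<pi> u * pmf (kernel \<eta> u) v = pmf \<pi> v * pmf (kernel \<eta> v) u" for u v
  proof (cases "u = v")
    case False
    have "pmf \<pi> u * pmf (kernel \<eta> u) v
        = ((\<Sum>i\<in>UNIV. of_bool (up u i = v) * arrival \<eta> u i * pmf \<pi> u)
          + (\<Sum>i\<in>UNIV. of_bool (down u i = v) * \<mu> i * pmf \<pi> u)) / L" for u v
      by (simp only: pmf_kernel times_divide_eq_right distrib_left sum_distrib_left mult_ac)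
    \<comment> \<open>The arrival sum from \<open>u\<close> to \<open>v\<close> matches the service
      sum from \<open>v\<close> to \<open>u\<close>, and vice versa.\<close>
    then show ?thesis
      using up_term[OF False] up_term[OF False[symmetric]] by simp
  qed simp
  then have "bind_pmf \<pi> (kernel \<eta>) = \<pi>" by (rule reversible_imp_invariant)
  then show ?thesis by blast
qed

section \<open>Realization by state-independent policies\<close>

lemma flow_realizable:
  assumes x: "\<And>e i. e \<in> E \<Longrightarrow> 0 \<le> x e i" "\<And>e i. e \<in> E \<Longrightarrow> i \<notin> e \<Longrightarrow> x e i = 0"
    "\<And>e. e \<in> E \<Longrightarrow> (\<Sum>i\<in>UNIV. x e i) = lamE e"
    and \<rho>: "\<And>i. \<mu> i * \<rho> i = lamI i + (\<Sum>e\<in>E. x e i)" "\<And>i. \<rho> i < 1"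
  shows "\<exists>\<eta>\<in>stable_policies E lamI lamE \<mu> B. state_independent E \<eta>
    \<and> (\<forall>i. workload E lamI lamE \<mu> B \<eta> i = \<rho> i)
    \<and> (\<forall>e\<in>E. \<forall>i. assignment_rate E lamI lamE \<mu> B \<eta> e i = x e i)"
proof -
  \<comment> \<open>With \<open>lamE e = 0\<close> the proportions are no distribution; a fixed
    server of the nonempty set \<open>e\<close> is chosen instead.\<close>
  define p where "p e = (if lamE e = 0 then return_pmf (SOME i. i \<in> e)
    else embed_pmf (\<lambda>i. x e i / lamE e))" for e
  define \<eta> :: "'i policy" where "\<eta> e u = p e" for e u
  have pmf_p: "pmf (p e) i = x e i / lamE e" if "e \<in> E" "lamE e \<noteq> 0" for e i
  proof -
    have pos: "lamE e > 0" using lamE_nonneg[of e] that by simp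
    have "pmf (embed_pmf (\<lambda>i. x e i / lamE e)) i = x e i / lamE e"
    proof (rule pmf_embed_pmf)
      show nonneg: "0 \<le> x e i / lamE e" for i using x(1) pos that by simp
      have "(\<integral>\<^sup>+i. ennreal (x e i / lamE e) \<partial>count_space UNIV) = ennreal (\<Sum>i\<in>UNIV. x e i / lamE e)"
        by (subst nn_integral_count_space_finite) (auto simp: sum_ennreal nonneg)
      then show "(\<integral>\<^sup>+i. ennreal (x e i / lamE e) \<partial>count_space UNIV) = 1"
        using x(3) that by (simp flip: sum_divide_distrib)
    qed
    then show ?thesis using that by (simp add: p_def)
  qed
  \<comment> \<open>When \<open>lamE e = 0\<close>, the nonnegative values \<open>x e i\<close> sum
    to zero and so vanish.\<close>
  have rate: "pmf (p e) i * lamE e = x e i" if "e \<in> E" for e i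
  proof (cases "lamE e = 0")
    case True
    then have "x e i = 0"
      using sum_nonneg_eq_0_iff[of UNIV "x e"] x(1,3) that by simp
    then show ?thesis using True by simp
  qed (use that pmf_p in simp)
  have "\<eta> \<in> policies E"
    unfolding policies_def \<eta>_def
  proof (intro CollectI ballI allI subsetI)
    fix e i assume e: "e \<in> E" and i: "i \<in> set_pmf (p e)"
    show "i \<in> e"
    proof (cases "lamE e = 0")
      case True
      have "e \<noteq> {}" using e nonempty by auto
      then show ?thesis using True i by (simp add: p_def some_in_eq)
    next
      case False
      then show ?thesis using i e x(2)[of e i] by (auto simp: set_pmf_iff pmf_p)
    qed
  qed
  have arr: "arrival \<eta> u i = \<mu> i * \<rho> i" for u i
    by (simp add: arrival_def \<eta>_def rate \<rho>(1))
  \<comment> \<open>Nonnegativity is inherited from the arrival rate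
    \<open>\<mu> i * \<rho> i\<close>.\<close>
  have "0 \<le> \<rho> i" for i
    using arrival_nonneg[of \<eta> 0 i] mu_pos[of i] by (simp add: arr zero_le_mult_iff)
  from product_geometric_invariant[OF arr this \<rho>(2)]
  obtain \<pi> where inv: "bind_pmf \<pi> (kernel \<eta>) = \<pi>" by blast
  have stable: "\<eta> \<in> stable_policies E lamI lamE \<mu> B"
    using inv \<open>\<eta> \<in> policies E\<close> by (auto simp: stable_iff)
  have assign: "assignment_rate E lamI lamE \<mu> B \<eta> e i = x e i" if "e \<in> E" for e i
    using rate[OF that, of i] by (simp add: assignment_rate_eq[OF inv] \<eta>_def mult.commute)
  \<comment> \<open>The workload is obtained from rate conservation and the assignment rates,
    instead of from the geometric law.\<close>
  have "\<mu> i * workload E lamI lamE \<mu> B \<eta> i = \<mu> i * \<rho> i" for i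
    by (simp add: mu_workload[OF stable] assign \<rho>(1))
  then have "workload E lamI lamE \<mu> B \<eta> i = \<rho> i" for i
    using mu_pos[of i] by (metis mult_cancel_left less_irrefl)
  moreover have "state_independent E \<eta>" by (simp add: state_independent_def \<eta>_def)
  ultimately show ?thesis using stable assign by blast
qed

text \<open>Once primary calls are served, server \<open>i\<close> has capacity \<open>c i\<close>
  left for overlapping regions, and the trapped demand inequalities are the feasibility condition
  for these capacities. The resulting flow only satisfies upper bounds; the equality of totals makes
  them equalities.\<close>

lemma workload_realizable:
  assumes lt: "\<And>i. \<rho> i < 1"
    and total: "(\<Sum>i\<in>UNIV. \<mu> i * \<rho> i) = total_rate E lamI lamE"
    and trapped: "\<And>S. trapped_demand E lamI lamE S \<le> (\<Sum>i\<in>S. \<mu> i * \<rho> i)"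
  shows "\<exists>\<eta>\<in>stable_policies E lamI lamE \<mu> B. \<rho> = workload E lamI lamE \<mu> B \<eta>"
proof -
  define c where "c i = \<mu> i * \<rho> i - lamI i" for i
  have "\<exists>x. (\<forall>e\<in>E. (\<forall>i. 0 \<le> x e i) \<and> (\<forall>i. i \<notin> e \<longrightarrow> x e i = 0) \<and> (\<Sum>i\<in>UNIV. x e i) = lamE e)
      \<and> (\<forall>i. (\<Sum>e\<in>E. x e i) \<le> c i)"
  proof (rule transport_feasible)
    show "sum lamE {e \<in> E. e \<subseteq> S} \<le> sum c S" for S
      using trapped[of S] by (simp add: trapped_demand_def c_def sum_subtractf)
  qed (use nonempty lamE_nonneg in simp_all)
  then obtain x where x: "\<forall>e\<in>E. (\<forall>i. 0 \<le> x e i) \<and> (\<forall>i. i \<notin> e \<longrightarrow> x e i = 0) \<and> (\<Sum>i\<in>UNIV. x e i) = lamE e"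
    and x_le: "\<forall>i. (\<Sum>e\<in>E. x e i) \<le> c i"
    by (elim exE conjE)
  have "(\<Sum>i\<in>UNIV. c i - (\<Sum>e\<in>E. x e i)) = sum c UNIV - (\<Sum>e\<in>E. \<Sum>i\<in>UNIV. x e i)"
    unfolding sum_subtractf by (subst sum.swap) simp
  also have "\<dots> = 0"
    using x total by (simp add: c_def sum_subtractf total_rate_def)
  finally have "c i - (\<Sum>e\<in>E. x e i) = 0" for i
    using sum_nonneg_eq_0_iff[of UNIV "\<lambda>i. c i - (\<Sum>e\<in>E. x e i)"] x_le by simp
  then have "\<mu> i * \<rho> i = lamI i + (\<Sum>e\<in>E. x e i)" for i
    by (simp add: c_def algebra_simps)
  from flow_realizable[of x \<rho>, OF _ _ _ this lt] x
  obtain \<eta> where "\<eta> \<in> stable_policies E lamI lamE \<mu> B"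
    and "\<forall>i. workload E lamI lamE \<mu> B \<eta> i = \<rho> i" by blast
  then show ?thesis by (intro bexI[of _ \<eta>]) (simp_all add: fun_eq_iff)
qed

end

theorem theorem1:
  fixes E :: "'i::finite set set"
    and lamI :: "'i \<Rightarrow> real"
    and lamE :: "'i set \<Rightarrow> real"
    and \<mu> :: "'i \<Rightarrow> real"
    and B :: "nat \<Rightarrow> 'i \<Rightarrow> nat"
  assumes "{} \<notin> E"
    and "\<And>e e'. e \<in> E \<Longrightarrow> e' \<in> E \<Longrightarrow> e \<noteq> e' \<Longrightarrow> \<not> e \<subseteq> e'"
    and "\<And>i. lamI i \<ge> 0"
    and "\<And>e. e \<in> E \<Longrightarrow> lamE e \<ge> 0"
    and "\<And>i. \<mu> i > 0"
    and "bij B"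
  shows "{\<rho>. \<exists>\<eta>\<in>stable_policies E lamI lamE \<mu> B. \<rho> = workload E lamI lamE \<mu> B \<eta>}
       = {\<rho>. (\<forall>i. 0 \<le> \<rho> i \<and> \<rho> i < 1)
            \<and> (\<Sum>i\<in>UNIV. \<mu> i * \<rho> i) = total_rate E lamI lamE
            \<and> (\<forall>S. (\<Sum>i\<in>S. \<mu> i * \<rho> i) \<ge> trapped_demand E lamI lamE S)}
     \<and> (\<forall>\<eta>\<in>stable_policies E lamI lamE \<mu> B.
          \<exists>\<eta>'\<in>stable_policies E lamI lamE \<mu> B. state_independent E \<eta>'
            \<and> (\<forall>i. workload E lamI lamE \<mu> B \<eta>' i = workload E lamI lamE \<mu> B \<eta> i)
            \<and> (\<forall>e\<in>E. \<forall>i\<in>e. assignment_rate E lamI lamE \<mu> B \<eta>' e i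
                              = assignment_rate E lamI lamE \<mu> B \<eta> e i))"
proof -
  interpret dispatch_system E lamI lamE \<mu> B
    using assms by unfold_locales auto
  show ?thesis
  proof (intro conjI ballI)
    show "{\<rho>. \<exists>\<eta>\<in>stable_policies E lamI lamE \<mu> B. \<rho> = workload E lamI lamE \<mu> B \<eta>}
       = {\<rho>. (\<forall>i. 0 \<le> \<rho> i \<and> \<rho> i < 1)
            \<and> (\<Sum>i\<in>UNIV. \<mu> i * \<rho> i) = total_rate E lamI lamE
            \<and> (\<forall>S. (\<Sum>i\<in>S. \<mu> i * \<rho> i) \<ge> trapped_demand E lamI lamE S)}"
      using workload_bounds total_rate_eq_workload trapped_demand_le_workload workload_realizable
      by (intro Collect_cong iffI) auto
  next
    fix \<eta> assume \<eta>: "\<eta> \<in> stable_policies E lamI lamE \<mu> B"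
    \<comment> \<open>The long-run assignment rates of \<open>\<eta>\<close> themselves form a flow
      whose server loads are the workloads of \<open>\<eta>\<close>.\<close>
    from flow_realizable[OF assignment_rate_flow[OF \<eta>] mu_workload[OF \<eta>] workload_bounds(2)[OF \<eta>]]
    show "\<exists>\<eta>'\<in>stable_policies E lamI lamE \<mu> B. state_independent E \<eta>'
            \<and> (\<forall>i. workload E lamI lamE \<mu> B \<eta>' i = workload E lamI lamE \<mu> B \<eta> i)
            \<and> (\<forall>e\<in>E. \<forall>i\<in>e. assignment_rate E lamI lamE \<mu> B \<eta>' e i
                              = assignment_rate E lamI lamE \<mu> B \<eta> e i)"
      by blast
  qed
qed

end
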